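(* Let $G$ be a locally compact group, let $1\le p<\infty$, let $a\in G$ be an element passing through compact subsets, and let $\omega:G\to(0,\infty)$ be a weight function. If the operator $T_{a,\omega}$ on $L^p(G)$ is $J$-class, then for each compact subset $\Delta\subset G$ with positive measure there are a sequence $(E_k)$ of Borel subsets of $\Delta$ and a strictly increasing sequence $(n_k)$ of positive integers such that $\lambda(E_k)\to\lambda(\Delta)$ and $$\lim_{k\to\infty}\ \underset{x\in E_k}{\mathrm{ess\,sup}}\ \tilde{\omega}_{n_k}(x)=0.$$
   Context: $G$ is a locally compact group with right Haar measure $\lambda$, and $L^p(G)$ is the complex $L^p$-space of Borel functions with respect to $\lambda$. An element $a\in G$ passes through compact subsets if for each compact $K\subset G$ there is $N\in\mathbb{N}$ such that $K\cap Ka^{m}=\emptyset$ and $K\cap Ka^{-m}=\emptyset$ for all $m\ge N$. A weight is a continuous function $\omega:G\to(0,\infty)$. The weighted translation operator $T_{a,\omega}:L^p(G)\to L^p(G)$ is $(T_{a,\omega}f)(x)=\omega(x)f(xa^{-1})$; $\omega$ is assumed to be such that this is a bounded linear operator on $L^p(G)$. For $m\in\mathbb{N}$, $\tilde{\omega}_m(x)=\left(\prod_{i=0}^{m-1}\omega(xa^{-i})\right)^{-1}$. For a bounded linear operator $T$ on a Banach space $X$ (not necessarily separable) and $x\in X$, the extended limit set $J_T(x)$ is the set of all $y\in X$ for which there exist a strictly increasing sequence of positive integers $(n_k)$ and a sequence $(x_k)$ in $X$ with $x_k\to x$ and $T^{n_k}x_k\to y$. $T$ is $J$-class if $J_T(x)=X$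 for some vector $x\in X$. *)

theory Defs
  imports "HOL-Analysis.Analysis" "HOL-Probability.Essential_Supremum"
begin

text \<open>
  A topological group is a type of class \<^class>\<open>topological_group_add\<close>. This class is written
  additively, but it is \<^emph>\<open>not\<close> commutative (it extends \<^class>\<open>group_add\<close>); the order of the
  summands therefore matters: the product $xy$ is written \<^term>\<open>x + y\<close>, and $x y^{-1}$ is
  written \<^term>\<open>x - y\<close>, which equals \<^term>\<open>x + (- y)\<close>.
\<close>

text \<open>The power $a^n$, in additive notation.\<close>
primrec npow :: "'a::monoid_add \<Rightarrow> nat \<Rightarrow> 'a" where
  "npow a 0 = 0"
| "npow a (Suc n) = a + npow a n"

text \<open>
  A nonzero, right-invariant Radon measure on the Borel sets. The group need not be
  second countable, so the regularity conditions have to be required explicitly.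
\<close>
definition right_haar_measure ::
  "'a::{topological_group_add, t2_space} measure \<Rightarrow> bool" where
  "right_haar_measure M \<longleftrightarrow>
     sets M = sets borel \<and>
     (\<forall>K. compact K \<longrightarrow> emeasure M K < \<infinity>) \<and>
     (\<forall>B \<in> sets borel. emeasure M B = (INF U \<in> {U. open U \<and> B \<subseteq> U}. emeasure M U)) \<and>
     (\<forall>U. open U \<longrightarrow> emeasure M U = (SUP K \<in> {K. compact K \<and> K \<subseteq> U}. emeasure M K)) \<and>
     (\<exists>B \<in> sets borel. emeasure M B \<noteq> 0) \<and>
     (\<forall>x. \<forall>B \<in> sets borel. emeasure M ((\<lambda>y. y + x) ` B) = emeasure M B)"

definition passes_through_compacts :: "'a::topological_group_add \<Rightarrow> bool" where
  "passes_through_compacts a \<longleftrightarrow>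
     (\<forall>K. compact K \<longrightarrow>
        (\<exists>N. \<forall>m\<ge>N. K \<inter> (\<lambda>x. x + npow a m) ` K = {} \<and>
                   K \<inter> (\<lambda>x. x - npow a m) ` K = {}))"

definition weight :: "('a::topological_space \<Rightarrow> real) \<Rightarrow> bool" where
  "weight \<omega> \<longleftrightarrow> continuous_on UNIV \<omega> \<and> (\<forall>x. 0 < \<omega> x)"

definition weighted_translation ::
  "'a::group_add \<Rightarrow> ('a \<Rightarrow> real) \<Rightarrow> ('a \<Rightarrow> complex) \<Rightarrow> 'a \<Rightarrow> complex" where
  "weighted_translation a \<omega> f = (\<lambda>x. complex_of_real (\<omega> x) * f (x - a))"

definition omega_tilde :: "'a::group_add \<Rightarrow> ('a \<Rightarrow> real) \<Rightarrow> nat \<Rightarrow> 'a \<Rightarrow> real" where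
  "omega_tilde a \<omega> m x = inverse (\<Prod>i<m. \<omega> (x - npow a i))"

text \<open>
  The complex space $L^p$ for real $p \ge 1$: functions with integrable $p$-th power, the
  $p$-norm on functions, and the space of classes of such functions modulo equality
  almost everywhere.
\<close>
definition Lp_fun :: "'a measure \<Rightarrow> real \<Rightarrow> ('a \<Rightarrow> complex) set" where
  "Lp_fun M p = {f \<in> borel_measurable M. integrable M (\<lambda>x. norm (f x) powr p)}"

definition Lp_norm :: "'a measure \<Rightarrow> real \<Rightarrow> ('a \<Rightarrow> complex) \<Rightarrow> real" where
  "Lp_norm M p f = (\<integral>x. norm (f x) powr p \<partial>M) powr (1 / p)"

definition Lp_class :: "'a measure \<Rightarrow> real \<Rightarrow> ('a \<Rightarrow> complex) \<Rightarrow> ('a \<Rightarrow> complex) set" where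
  "Lp_class M p f = {g \<in> Lp_fun M p. AE x in M. g x = f x}"

definition Lp_space :: "'a measure \<Rightarrow> real \<Rightarrow> ('a \<Rightarrow> complex) set set" where
  "Lp_space M p = Lp_class M p ` Lp_fun M p"

text \<open>The norm distance of two classes; see \<open>Lp_dist_class\<close> below.\<close>
definition Lp_dist ::
  "'a measure \<Rightarrow> real \<Rightarrow> ('a \<Rightarrow> complex) set \<Rightarrow> ('a \<Rightarrow> complex) set \<Rightarrow> real" where
  "Lp_dist M p F H = (THE r. \<forall>f\<in>F. \<forall>h\<in>H. r = Lp_norm M p (\<lambda>x. f x - h x))"

text \<open>
  \<open>S\<close>, given on functions, induces a bounded linear operator on \<^term>\<open>Lp_space M p\<close>;
  \<open>Lp_map M p S\<close> is the induced operator on classes, see \<open>Lp_map_class\<close> below.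
\<close>
definition Lp_bounded_linear ::
  "'a measure \<Rightarrow> real \<Rightarrow> (('a \<Rightarrow> complex) \<Rightarrow> 'a \<Rightarrow> complex) \<Rightarrow> bool" where
  "Lp_bounded_linear M p S \<longleftrightarrow>
     (\<forall>f \<in> Lp_fun M p. S f \<in> Lp_fun M p) \<and>
     (\<forall>f \<in> Lp_fun M p. \<forall>g \<in> Lp_fun M p. AE x in M. S (\<lambda>y. f y + g y) x = S f x + S g x) \<and>
     (\<forall>c. \<forall>f \<in> Lp_fun M p. AE x in M. S (\<lambda>y. c * f y) x = c * S f x) \<and>
     (\<exists>C. \<forall>f \<in> Lp_fun M p. Lp_norm M p (S f) \<le> C * Lp_norm M p f)"

definition Lp_map ::
  "'a measure \<Rightarrow> real \<Rightarrow> (('a \<Rightarrow> complex) \<Rightarrow> 'a \<Rightarrow> complex)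
     \<Rightarrow> ('a \<Rightarrow> complex) set \<Rightarrow> ('a \<Rightarrow> complex) set" where
  "Lp_map M p S F = (\<Union>f\<in>F. Lp_class M p (S f))"

text \<open>
  The extended limit set $J_T(x)$ and $J$-class operators on a normed space, given by its
  carrier \<open>X\<close> and its norm distance \<open>d\<close>.
\<close>
definition J_set :: "'b set \<Rightarrow> ('b \<Rightarrow> 'b \<Rightarrow> real) \<Rightarrow> ('b \<Rightarrow> 'b) \<Rightarrow> 'b \<Rightarrow> 'b set" where
  "J_set X d T x =
     {y \<in> X. \<exists>(n :: nat \<Rightarrow> nat) u. strict_mono n \<and> (\<forall>k. 0 < n k) \<and> (\<forall>k. u k \<in> X) \<and>
        (\<lambda>k. d (u k) x) \<longlonglongrightarrow> 0 \<and> (\<lambda>k. d ((T ^^ n k) (u k)) y) \<longlonglongrightarrow> 0}"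

definition J_class :: "'b set \<Rightarrow> ('b \<Rightarrow> 'b \<Rightarrow> real) \<Rightarrow> ('b \<Rightarrow> 'b) \<Rightarrow> bool" where
  "J_class X d T \<longleftrightarrow> (\<exists>x\<in>X. J_set X d T x = X)"

lemma Lp_class_self: "f \<in> Lp_fun M p \<Longrightarrow> f \<in> Lp_class M p f"
  by (simp add: Lp_class_def)

lemma Lp_class_eqI: "AE x in M. f x = g x \<Longrightarrow> Lp_class M p f = Lp_class M p g"
proof -
  assume fg: "AE x in M. f x = g x"
  have "(AE x in M. h x = f x) \<longleftrightarrow> (AE x in M. h x = g x)" for h
  proof
    assume "AE x in M. h x = f x"
    with fg show "AE x in M. h x = g x" by eventually_elim simp
  next
    assume "AE x in M. h x = g x"
    with fg show "AE x in M. h x = f x" by eventually_elim simp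
  qed
  then show ?thesis by (simp add: Lp_class_def)
qed

lemma Lp_norm_cong_AE:
  assumes "f \<in> borel_measurable M" "g \<in> borel_measurable M" "AE x in M. f x = g x"
  shows "Lp_norm M p f = Lp_norm M p g"
proof -
  have "(\<integral>x. norm (f x) powr p \<partial>M) = (\<integral>x. norm (g x) powr p \<partial>M)"
    using assms by (intro integral_cong_AE) auto
  then show ?thesis by (simp add: Lp_norm_def)
qed

lemma Lp_dist_class:
  assumes f: "f \<in> Lp_fun M p" and h: "h \<in> Lp_fun M p"
  shows "Lp_dist M p (Lp_class M p f) (Lp_class M p h) = Lp_norm M p (\<lambda>x. f x - h x)"
proof -
  have eq: "Lp_norm M p (\<lambda>x. f x - h x) = Lp_norm M p (\<lambda>x. f' x - h' x)"
    if "f' \<in> Lp_class M p f" "h' \<in> Lp_class M p h" for f' h'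
  proof (rule Lp_norm_cong_AE)
    have [measurable]: "f \<in> borel_measurable M" "h \<in> borel_measurable M"
        "f' \<in> borel_measurable M" "h' \<in> borel_measurable M"
      using that f h by (auto simp: Lp_class_def Lp_fun_def)
    show "(\<lambda>x. f x - h x) \<in> borel_measurable M" "(\<lambda>x. f' x - h' x) \<in> borel_measurable M"
      by measurable
    have "AE x in M. f' x = f x" "AE x in M. h' x = h x"
      using that by (auto simp: Lp_class_def)
    then show "AE x in M. f x - h x = f' x - h' x" by eventually_elim simp
  qed
  show ?thesis
    unfolding Lp_dist_def
  proof (rule the_equality)
    show "\<forall>f'\<in>Lp_class M p f. \<forall>h'\<in>Lp_class M p h.
        Lp_norm M p (\<lambda>x. f x - h x) = Lp_norm M p (\<lambda>x. f' x - h' x)"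
      by (intro ballI eq)
  next
    fix r assume "\<forall>f'\<in>Lp_class M p f. \<forall>h'\<in>Lp_class M p h.
        r = Lp_norm M p (\<lambda>x. f' x - h' x)"
    then show "r = Lp_norm M p (\<lambda>x. f x - h x)"
      using Lp_class_self[OF f] Lp_class_self[OF h] by blast
  qed
qed

lemma Lp_map_class:
  assumes p: "1 \<le> p" and S: "Lp_bounded_linear M p S" and f: "f \<in> Lp_fun M p"
  shows "Lp_map M p S (Lp_class M p f) = Lp_class M p (S f)"
proof -
  have "Lp_class M p (S g) = Lp_class M p (S f)" if g: "g \<in> Lp_class M p f" for g
  proof (rule Lp_class_eqI)
    have gL: "g \<in> Lp_fun M p" and ae: "AE x in M. g x = f x"
      using g by (auto simp: Lp_class_def)
    have [measurable]: "f \<in> borel_measurable M" "g \<in> borel_measurable M"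
      using f gL by (auto simp: Lp_fun_def)
    define h where "h = (\<lambda>x. g x + (- f x))"
    have [measurable]: "h \<in> borel_measurable M" by (simp add: h_def)
    have h0: "AE x in M. h x = 0" using ae by (simp add: h_def)
    have "integrable M (\<lambda>x. norm (h x) powr p) \<longleftrightarrow> integrable M (\<lambda>x. 0 :: real)"
      using h0 by (intro integrable_cong_AE) auto
    then have hL: "h \<in> Lp_fun M p" by (simp add: Lp_fun_def)
    have "Lp_norm M p h = Lp_norm M p (\<lambda>x. 0)"
      using h0 by (intro Lp_norm_cong_AE) auto
    then have "Lp_norm M p h = 0" using p by (simp add: Lp_norm_def)
    moreover obtain C where "\<And>k. k \<in> Lp_fun M p \<Longrightarrow> Lp_norm M p (S k) \<le> C * Lp_norm M p k"
      using S unfolding Lp_bounded_linear_def by blast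
    ultimately have "Lp_norm M p (S h) \<le> 0" using hL by fastforce
    then have "(\<integral>x. norm (S h x) powr p \<partial>M) = 0"
      by (simp add: Lp_norm_def)
    moreover have Sh: "S h \<in> Lp_fun M p" using S hL by (auto simp: Lp_bounded_linear_def)
    ultimately have "AE x in M. norm (S h x) powr p = 0"
      by (subst (asm) integral_nonneg_eq_0_iff_AE) (auto simp: Lp_fun_def)
    then have Sh0: "AE x in M. S h x = 0" by simp
    have "AE x in M. S (\<lambda>y. h y + f y) x = S h x + S f x"
      using S hL f by (auto simp: Lp_bounded_linear_def)
    moreover have "(\<lambda>y. h y + f y) = g" by (auto simp: h_def)
    ultimately show "AE x in M. S g x = S f x"
      using Sh0 by auto
  qed
  then show ?thesis
    unfolding Lp_map_def using Lp_class_self[OF f] by blast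
qed

end

theory Submission
  imports Defs
begin

text \<open>
  Apply the $J$-class property to the indicator of $\Delta$: there are $u_k \to f$ with
  $T^{n_k} u_k \to 1_\Delta$. Since $(T^n u)(x) = u(x a^{-n}) / \tilde\omega_n(x)$, the weight
  $\tilde\omega_{n_k}(x)$ is small as soon as $(T^{n_k} u_k)(x)$ is close to $1$ and
  $u_k(x a^{-n_k})$ is small. The first holds for $x \in \Delta$ off a set of small measure by
  Markov's inequality. The second also does, by invariance of the measure: $u_k$ is close to the
  fixed $f$, and $f$ is small on most of $\Delta a^{-n_k}$ because these sets leave every set of
  finite measure.
\<close>

section \<open>Iterates of the operator, on functions and on classes\<close>

lemma npow_Suc_right: "npow a (Suc n) = npow a n + a"
  by (induction n) (simp_all flip: add.assoc)

text \<open>Negation reverses the order of summands in a noncommutative group, so the new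
  \<open>a\<close> arrives on the right of \<open>npow a n\<close>; it may be moved to the left
  because powers of \<open>a\<close> commute with \<open>a\<close>.\<close>

lemma diff_diff_npow: "x - a - npow a n = x - npow a (Suc n)" for a x :: "'a::group_add"
  by (simp only: npow_Suc_right diff_conv_add_uminus minus_add add.assoc)

lemma weighted_translation_funpow:
  "(weighted_translation a \<omega> ^^ n) f x =
     complex_of_real (\<Prod>i<n. \<omega> (x - npow a i)) * f (x - npow a n)"
proof (induction n arbitrary: x)
  case (Suc n)
  then show ?case
    \<comment> \<open>The induction hypothesis is used at \<open>x - a\<close>, which shifts every
      index by one; so the factor with \<open>i = 0\<close> is the one to split off.\<close>
    by (simp add: weighted_translation_def diff_diff_npow prod.lessThan_Suc_shift
        del: npow.simps(2) prod.lessThan_Suc)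
qed simp

text \<open>Membership in \<open>Lp_fun M p\<close> is carried through the same induction because
  \<open>Lp_map_class\<close> asks for it at each step.\<close>

lemma Lp_map_funpow:
  assumes "1 \<le> p" "Lp_bounded_linear M p S" "f \<in> Lp_fun M p"
  shows "(S ^^ n) f \<in> Lp_fun M p \<and>
    (Lp_map M p S ^^ n) (Lp_class M p f) = Lp_class M p ((S ^^ n) f)"
proof (induction n)
  case (Suc n)
  moreover have "S ((S ^^ n) f) \<in> Lp_fun M p"
    using Suc assms(2) by (simp add: Lp_bounded_linear_def)
  ultimately show ?case using Lp_map_class[OF assms(1,2)] by simp
qed (simp add: assms)

section \<open>Differences in L^p and convergence in measure\<close>

lemma Lp_fun_diff:
  assumes p: "0 \<le> p" and f: "f \<in> Lp_fun M p" and g: "g \<in> Lp_fun M p"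
  shows "(\<lambda>x. f x - g x) \<in> Lp_fun M p"
proof -
  have [measurable]: "f \<in> borel_measurable M" "g \<in> borel_measurable M"
    using f g by (auto simp: Lp_fun_def)
  \<comment> \<open>This crude bound replaces Minkowski's inequality: only integrability of the
    difference is wanted, not a norm estimate.\<close>
  have bound: "norm (u - v) powr p \<le> 2 powr p * (norm u powr p + norm v powr p)" for u v :: complex
  proof -
    have "norm (u - v) \<le> 2 * max (norm u) (norm v)"
      using norm_triangle_ineq4[of u v] by linarith
    then have "norm (u - v) powr p \<le> (2 * max (norm u) (norm v)) powr p"
      using p by (intro powr_mono2) auto
    also have "\<dots> = 2 powr p * max (norm u) (norm v) powr p"
      by (simp add: powr_mult)
    also have "\<dots> \<le> 2 powr p * (norm u powr p + norm v powr p)"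
      by (intro mult_left_mono) (auto simp: max_def)
    finally show ?thesis .
  qed
  have "integrable M (\<lambda>x. 2 powr p * (norm (f x) powr p + norm (g x) powr p))"
    using f g by (auto simp: Lp_fun_def)
  then have "integrable M (\<lambda>x. norm (f x - g x) powr p)"
    by (rule Bochner_Integration.integrable_bound) (use bound in auto)
  then show ?thesis by (simp add: Lp_fun_def)
qed

text \<open>Markov's inequality for the p-th power of the modulus, with the integral written through
  \<open>Lp_norm\<close> so that norm convergence can be inserted directly.\<close>

lemma Lp_Markov_inequality:
  assumes p: "0 < p" and f: "f \<in> Lp_fun M p" and c: "0 < c"
  shows "emeasure M {x \<in> space M. c \<le> norm (f x)} \<le> ennreal ((Lp_norm M p f / c) powr p)"
proof -
  have "{x \<in> space M. c \<le> norm (f x)} = {x \<in> space M. c powr p \<le> norm (f x) powr p}"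
    using p c by (auto intro: powr_mono2) (metis linorder_not_le norm_ge_zero powr_less_mono2)
  also have "emeasure M \<dots> \<le> ennreal ((1 / c powr p) * (\<integral>x. norm (f x) powr p \<partial>M))"
    using f c by (intro integral_Markov_inequality) (auto simp: Lp_fun_def)
  also have "(1 / c powr p) * (\<integral>x. norm (f x) powr p \<partial>M) = (Lp_norm M p f / c) powr p"
    using p c by (simp add: Lp_norm_def powr_divide powr_powr)
  finally show ?thesis .
qed

lemma Lp_tendsto_0_imp_measure:
  assumes p: "0 < p" and f: "\<And>k. f k \<in> Lp_fun M p" and lim: "(\<lambda>k. Lp_norm M p (f k)) \<longlonglongrightarrow> 0"
    and c: "0 < c"
  shows "(\<lambda>k. emeasure M {x \<in> space M. c \<le> norm (f k x)}) \<longlonglongrightarrow> 0"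
proof (rule tendsto_sandwich[OF _ _ tendsto_const])
  have "(\<lambda>k. Lp_norm M p (f k) / c) \<longlonglongrightarrow> 0"
    using tendsto_divide[OF lim tendsto_const, of c] c by simp
  then have "(\<lambda>k. (Lp_norm M p (f k) / c) powr p) \<longlonglongrightarrow> 0 powr p"
    \<comment> \<open>The base tends to 0, where continuity of \<open>powr\<close> needs a
      nonnegative base and a positive exponent.\<close>
    using p c by (intro tendsto_powr') (auto simp: Lp_norm_def)
  then show "(\<lambda>k. ennreal ((Lp_norm M p (f k) / c) powr p)) \<longlonglongrightarrow> 0"
    using p by (simp flip: ennreal_0)
qed (use Lp_Markov_inequality[OF p f c] in simp_all)

section \<open>Translates of a compact set by powers of \<open>a\<close>\<close>

lemma translate_compact_eventually_avoids:
  fixes a :: "'a::{topological_group_add, t2_space}"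
  assumes "passes_through_compacts a" "compact K"
  shows "eventually (\<lambda>n. y \<notin> (\<lambda>x. x - npow a n) ` K) sequentially"
proof -
  \<comment> \<open>With \<open>y\<close> adjoined, disjointness of a compact set from its own
    translates also says that \<open>y\<close> avoids the translates of \<open>K\<close>.\<close>
  have "compact (insert y K)" using assms(2) by simp
  with assms(1) obtain N
    where N: "\<And>m. m \<ge> N \<Longrightarrow> insert y K \<inter> (\<lambda>x. x - npow a m) ` insert y K = {}"
    unfolding passes_through_compacts_def by metis
  have "y \<notin> (\<lambda>x. x - npow a m) ` K" if "m \<ge> N" for m
    using N[OF that] by auto
  then show ?thesis unfolding eventually_sequentially by auto
qed

lemma compact_translate_borel:
  fixes K :: "'a::{topological_group_add, t2_space} set"
  assumes "compact K"
  shows "(\<lambda>x. x - t) ` K \<in> sets borel"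
proof -
  have "compact ((\<lambda>x. x - t) ` K)"
    using assms by (intro compact_continuous_image continuous_intros)
  then show ?thesis by (intro borel_closed compact_imp_closed)
qed

text \<open>Each point lies in only finitely many of the translates, so the indicators tend to 0
  pointwise. Finite measure of \<open>H\<close> lets its indicator dominate them; \<open>H\<close>
  is not approximated by compact sets.\<close>

lemma emeasure_translate_compact_tendsto_0:
  fixes a :: "'a::{topological_group_add, t2_space}"
  assumes "passes_through_compacts a" "compact K" and M: "sets M = sets borel"
    and H: "H \<in> sets M" "emeasure M H < \<infinity>"
  shows "(\<lambda>n. emeasure M (H \<inter> (\<lambda>x. x - npow a n) ` K)) \<longlonglongrightarrow> 0"
proof -
  define D where "D n = H \<inter> (\<lambda>x. x - npow a n) ` K" for n
  have D: "D n \<in> sets M" for n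
    using H M compact_translate_borel[OF assms(2)] by (auto simp: D_def)
  have "(\<lambda>n. indicator (D n) y :: ennreal) \<longlonglongrightarrow> 0" for y
    by (rule tendsto_eventually, rule eventually_mono[OF translate_compact_eventually_avoids[OF assms(1,2), of y]])
      (simp add: D_def)
  then have "(\<lambda>n. \<integral>\<^sup>+y. indicator (D n) y \<partial>M) \<longlonglongrightarrow> (\<integral>\<^sup>+y. 0 \<partial>M)"
    using D H by (intro nn_integral_dominated_convergence[where w = "indicator H"])
      (auto simp: D_def split: split_indicator)
  then show ?thesis using D by (simp add: D_def)
qed

section \<open>Measurability and smallness of \<open>omega_tilde\<close>\<close>

lemma omega_tilde_measurable:
  fixes a :: "'a::{topological_group_add, t2_space}"
  assumes "weight \<omega>"
  shows "omega_tilde a \<omega> n \<in> borel_measurable borel"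
proof (rule borel_measurable_continuous_onI)
  have "continuous_on UNIV (\<lambda>x. \<omega> (x - npow a i))" for i
    using continuous_on_compose2[of UNIV \<omega> UNIV "\<lambda>x. x - npow a i"] assms
    by (simp add: weight_def continuous_on_diff)
  moreover have "(\<Prod>i<n. \<omega> (x - npow a i)) \<noteq> 0" for x
    using assms by (simp add: weight_def) (metis less_irrefl)
  ultimately show "continuous_on UNIV (omega_tilde a \<omega> n)"
    unfolding omega_tilde_def by (intro continuous_intros) auto
qed

text \<open>Let \<open>W\<close> be the inverse of \<open>omega_tilde a \<omega> n x\<close>. The
  iterate at \<open>x\<close> has modulus \<open>W * norm (f (x - npow a n))\<close>, which exceeds
  1/2 as the iterate is near 1; hence 1/2 < \<open>W * c\<close>.\<close>

lemma omega_tilde_less: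
  assumes \<omega>: "weight \<omega>" and Tf: "norm ((weighted_translation a \<omega> ^^ n) f x - 1) < 1 / 2"
    and f: "norm (f (x - npow a n)) < c"
  shows "omega_tilde a \<omega> n x < 2 * c"
proof -
  define W where "W = (\<Prod>i<n. \<omega> (x - npow a i))"
  have W: "0 < W" using \<omega> by (simp add: W_def weight_def prod_pos)
  have "1 - norm ((weighted_translation a \<omega> ^^ n) f x) < 1 / 2"
    using Tf norm_triangle_ineq2[of 1 "(weighted_translation a \<omega> ^^ n) f x"]
    by (simp add: norm_minus_commute)
  then have "1 / 2 < norm ((weighted_translation a \<omega> ^^ n) f x)" by simp
  also have "\<dots> = W * norm (f (x - npow a n))"
    using W unfolding weighted_translation_funpow W_def[symmetric] by (simp add: norm_mult)
  also have "\<dots> < W * c" using W f by simp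
  finally have "inverse W < 2 * c" using W by (simp add: field_simps)
  then show ?thesis by (simp add: omega_tilde_def W_def)
qed

section \<open>The J-class property on representatives, and the resulting exceptional sets\<close>

text \<open>Translates the property from classes to functions by choosing representatives. The
  function \<open>f\<close> represents the J-class vector and is fixed before the target
  \<open>g\<close>.\<close>

lemma J_class_approximating_functions:
  assumes p: "1 \<le> p" and S: "Lp_bounded_linear M p S"
    and J: "J_class (Lp_space M p) (Lp_dist M p) (Lp_map M p S)"
  obtains f where "f \<in> Lp_fun M p"
    and "\<And>g. g \<in> Lp_fun M p \<Longrightarrow> \<exists>(n :: nat \<Rightarrow> nat) u. strict_mono n \<and> (\<forall>k. u k \<in> Lp_fun M p) \<and>
      (\<lambda>k. Lp_norm M p (\<lambda>x. u k x - f x)) \<longlonglongrightarrow> 0 \<and>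
      (\<lambda>k. Lp_norm M p (\<lambda>x. (S ^^ n k) (u k) x - g x)) \<longlonglongrightarrow> 0"
proof -
  from J obtain f where f: "f \<in> Lp_fun M p"
    and all: "J_set (Lp_space M p) (Lp_dist M p) (Lp_map M p S) (Lp_class M p f) = Lp_space M p"
    unfolding J_class_def by (auto simp: Lp_space_def)
  show thesis
  proof (rule that[OF f])
    fix g assume g: "g \<in> Lp_fun M p"
    then have "Lp_class M p g \<in> J_set (Lp_space M p) (Lp_dist M p) (Lp_map M p S) (Lp_class M p f)"
      unfolding all by (simp add: Lp_space_def)
    then obtain n :: "nat \<Rightarrow> nat" and U where n: "strict_mono n" and U: "\<And>k. U k \<in> Lp_space M p"
      and lim: "(\<lambda>k. Lp_dist M p (U k) (Lp_class M p f)) \<longlonglongrightarrow> 0"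
        "(\<lambda>k. Lp_dist M p ((Lp_map M p S ^^ n k) (U k)) (Lp_class M p g)) \<longlonglongrightarrow> 0"
      unfolding J_set_def by blast
    have "\<exists>u. \<forall>k. u k \<in> Lp_fun M p \<and> U k = Lp_class M p (u k)"
      using U by (intro choice) (auto simp: Lp_space_def)
    then obtain u where u: "\<And>k. u k \<in> Lp_fun M p" and Uu: "\<And>k. U k = Lp_class M p (u k)"
      by blast
    show "\<exists>(n :: nat \<Rightarrow> nat) u. strict_mono n \<and> (\<forall>k. u k \<in> Lp_fun M p) \<and>
      (\<lambda>k. Lp_norm M p (\<lambda>x. u k x - f x)) \<longlonglongrightarrow> 0 \<and>
      (\<lambda>k. Lp_norm M p (\<lambda>x. (S ^^ n k) (u k) x - g x)) \<longlonglongrightarrow> 0"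
      using n u lim by (intro exI[of _ n] exI[of _ u])
        (simp add: Uu Lp_map_funpow[OF p S] Lp_dist_class f g)
  qed
qed

text \<open>Right invariance moves \<open>B k\<close> onto the part of the translated compact set
  where \<open>u k\<close> is large. There either \<open>u k - f\<close> is large, which is rare by
  convergence in measure, or \<open>f\<close> is large, on a fixed set of finite measure that the
  translates leave.\<close>

lemma emeasure_shifted_tendsto_0:
  fixes a :: "'a::{topological_group_add, t2_space}"
  assumes M: "right_haar_measure M" and p: "0 < p" and a: "passes_through_compacts a"
    and K: "compact K" and n: "strict_mono n"
    and f: "f \<in> Lp_fun M p" and u: "\<And>k. u k \<in> Lp_fun M p"
    and lim: "(\<lambda>k. Lp_norm M p (\<lambda>x. u k x - f x)) \<longlonglongrightarrow> 0" and c: "0 < c"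
  defines "B \<equiv> \<lambda>k. {x \<in> K. c \<le> norm (u k (x - npow a (n k)))}"
  shows "B k \<in> sets M" and "(\<lambda>k. emeasure M (B k)) \<longlonglongrightarrow> 0"
proof -
  have sM: "sets M = sets borel" and spM: "space M = UNIV"
    and inv: "\<And>x A. A \<in> sets borel \<Longrightarrow> emeasure M ((\<lambda>y. y + x) ` A) = emeasure M A"
    using M by (auto simp: right_haar_measure_def dest: sets_eq_imp_space_eq)
  have fm[measurable]: "f \<in> borel_measurable M" and um[measurable]: "\<And>k. u k \<in> borel_measurable M"
    using f u by (auto simp: Lp_fun_def)
  define K' where "K' k = (\<lambda>x. x - npow a (n k)) ` K" for k
  have K'[measurable]: "K' k \<in> sets M" for k
    using compact_translate_borel[OF K] sM by (simp add: K'_def)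
  define A where "A k = {x \<in> space M. c / 2 \<le> norm (u k x - f x)}" for k
  define H where "H = {x \<in> space M. c / 2 \<le> norm (f x)}"
  have [measurable]: "A k \<in> sets M" "H \<in> sets M" for k unfolding A_def H_def by measurable
  define C where "C k = {x \<in> space M. c \<le> norm (u k x)} \<inter> K' k" for k
  have C[measurable]: "C k \<in> sets M" for k unfolding C_def by measurable
  have BC: "B k = (\<lambda>y. y + npow a (n k)) ` C k" for k
    by (force simp: B_def C_def K'_def spM image_iff)
  \<comment> \<open>The image form serves invariance; the preimage form under a continuous map gives
    measurability.\<close>
  have "B k = (\<lambda>x. x - npow a (n k)) -` C k" for k
    by (auto simp: BC image_iff) (metis diff_add_cancel)
  moreover have "(\<lambda>x. x - npow a (n k)) \<in> M \<rightarrow>\<^sub>M M" for k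
    unfolding measurable_cong_sets[OF sM sM]
    by (intro borel_measurable_continuous_onI continuous_intros)
  ultimately show "B k \<in> sets M" for k
    using measurable_sets[OF _ C[of k], of "\<lambda>x. x - npow a (n k)" M] spM by simp
  have "emeasure M H \<le> ennreal ((Lp_norm M p f / (c / 2)) powr p)"
    using Lp_Markov_inequality[OF p f, of "c / 2"] c by (simp add: H_def)
  then have Hfin: "emeasure M H < \<infinity>" using le_less_trans by fastforce
  \<comment> \<open>If the sum of two moduli is at least \<open>c\<close>, one of them is at least
    \<open>c / 2\<close>.\<close>
  have "C k \<subseteq> A k \<union> (H \<inter> K' k)" for k
  proof
    fix x assume x: "x \<in> C k"
    then have "c \<le> norm (u k x - f x) + norm (f x)"
      using norm_triangle_sub[of "u k x" "f x"] by (simp add: C_def add.commute)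
    with x show "x \<in> A k \<union> (H \<inter> K' k)" by (auto simp: A_def C_def H_def)
  qed
  then have "emeasure M (C k) \<le> emeasure M (A k) + emeasure M (H \<inter> K' k)" for k
    by (intro order_trans[OF emeasure_mono emeasure_subadditive]) auto
  moreover have "emeasure M (B k) = emeasure M (C k)" for k
    using inv C sM by (simp add: BC)
  ultimately have bound: "emeasure M (B k) \<le> emeasure M (A k) + emeasure M (H \<inter> K' k)" for k
    by simp
  have "(\<lambda>k. emeasure M (A k)) \<longlonglongrightarrow> 0"
    unfolding A_def using p c by (intro Lp_tendsto_0_imp_measure[OF p] Lp_fun_diff u f lim) auto
  moreover have "(\<lambda>k. emeasure M (H \<inter> K' k)) \<longlonglongrightarrow> 0"
    using LIMSEQ_subseq_LIMSEQ[OF emeasure_translate_compact_tendsto_0[OF a K sM _ Hfin] n]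
    by (simp add: K'_def o_def)
  ultimately have lim: "(\<lambda>k. emeasure M (A k) + emeasure M (H \<inter> K' k)) \<longlonglongrightarrow> 0"
    using tendsto_add by fastforce
  show "(\<lambda>k. emeasure M (B k)) \<longlonglongrightarrow> 0"
    by (rule tendsto_sandwich[OF _ _ tendsto_const lim]) (simp_all add: bound)
qed

text \<open>One term of the desired sequences, with a single tolerance \<open>c\<close> for both the
  lost measure and the weight. The free lower bound \<open>N\<close> will make the exponents
  strictly increasing.\<close>

lemma J_class_omega_tilde_small:
  fixes M :: "'a::{topological_group_add, t2_space} measure"
  assumes M: "right_haar_measure M" and p: "1 \<le> p" and a: "passes_through_compacts a"
    and \<omega>: "weight \<omega>" and bl: "Lp_bounded_linear M p (weighted_translation a \<omega>)"
    and J: "J_class (Lp_space M p) (Lp_dist M p) (Lp_map M p (weighted_translation a \<omega>))"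
    and K: "compact K" and c: "0 < c"
  shows "\<exists>n>N. \<exists>E\<in>sets borel. E \<subseteq> K \<and> emeasure M (K - E) < ennreal c \<and>
    (\<forall>x\<in>E. omega_tilde a \<omega> n x < c)"
proof -
  have sM: "sets M = sets borel" and spM: "space M = UNIV" and Kfin: "emeasure M K < \<infinity>"
    using M K by (auto simp: right_haar_measure_def dest: sets_eq_imp_space_eq)
  have Ks[measurable]: "K \<in> sets M" using K sM by (simp add: borel_closed compact_imp_closed)
  define T where "T = weighted_translation a \<omega>"
  define g where "g = (indicator K :: 'a \<Rightarrow> complex)"
  have "(\<lambda>x. norm (g x) powr p) = indicator K"
    using p by (auto simp: g_def indicator_def)
  then have g: "g \<in> Lp_fun M p"
    using Kfin by (auto simp: Lp_fun_def g_def)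
  obtain f n u where f: "f \<in> Lp_fun M p" and n: "strict_mono (n :: nat \<Rightarrow> nat)"
    and u: "\<And>k. u k \<in> Lp_fun M p"
    and lim: "(\<lambda>k. Lp_norm M p (\<lambda>x. u k x - f x)) \<longlonglongrightarrow> 0"
      "(\<lambda>k. Lp_norm M p (\<lambda>x. (T ^^ n k) (u k) x - g x)) \<longlonglongrightarrow> 0"
    unfolding T_def
    by (rule J_class_approximating_functions[OF p bl J]) (use g in blast)
  have Tu: "(T ^^ m) (u k) \<in> Lp_fun M p" for m k
    using Lp_map_funpow[OF p bl u] by (simp add: T_def)
  \<comment> \<open>The thresholds \<open>c / 2\<close> here and 1/2 in \<open>B\<close> are those
    of \<open>omega_tilde_less\<close>, which then yields \<open>2 * (c / 2) = c\<close> off both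
    sets.\<close>
  define A where "A k = {x \<in> K. c / 2 \<le> norm (u k (x - npow a (n k)))}" for k
  define B where "B k = {x \<in> space M. 1 / 2 \<le> norm ((T ^^ n k) (u k) x - g x)}" for k
  have A: "A k \<in> sets M" "(\<lambda>k. emeasure M (A k)) \<longlonglongrightarrow> 0" for k
    unfolding A_def using p c
    by (intro emeasure_shifted_tendsto_0[OF M _ a K n f u lim(1)]; simp)+
  have D: "(\<lambda>x. (T ^^ n k) (u k) x - g x) \<in> Lp_fun M p" for k
    using p by (intro Lp_fun_diff Tu g) auto
  then have Bs: "B k \<in> sets M" for k
  proof -
    have [measurable]: "(\<lambda>x. (T ^^ n k) (u k) x - g x) \<in> borel_measurable M"
      using D by (simp add: Lp_fun_def)
    show ?thesis unfolding B_def by measurable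
  qed
  have Blim: "(\<lambda>k. emeasure M (B k)) \<longlonglongrightarrow> 0"
    unfolding B_def using p by (intro Lp_tendsto_0_imp_measure[OF _ D lim(2)]) auto
  have "(\<lambda>k. emeasure M (A k) + emeasure M (B k)) \<longlonglongrightarrow> 0 + 0"
    using A(2) Blim by (rule tendsto_add)
  then have "eventually (\<lambda>k. emeasure M (A k) + emeasure M (B k) < ennreal c) sequentially"
    using c by (intro order_tendstoD(2)) auto
  then have "eventually (\<lambda>k. emeasure M (A k) + emeasure M (B k) < ennreal c \<and> N < k) sequentially"
    by (intro eventually_conj eventually_gt_at_top)
  then obtain k where k: "emeasure M (A k) + emeasure M (B k) < ennreal c" "N < k"
    by (auto dest: eventually_happens)
  define E where "E = K - (A k \<union> B k)"
  have "emeasure M (K - E) \<le> emeasure M (A k \<union> B k)"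
    using A(1) Bs by (intro emeasure_mono) (auto simp: E_def)
  also have "\<dots> \<le> emeasure M (A k) + emeasure M (B k)"
    using A(1) Bs by (intro emeasure_subadditive) auto
  finally have "emeasure M (K - E) < ennreal c" using k(1) by simp
  moreover have "omega_tilde a \<omega> (n k) x < c" if "x \<in> E" for x
    using omega_tilde_less[OF \<omega>, where c = "c / 2" and f = "u k"] that
    by (auto simp: E_def A_def B_def spM g_def T_def)
  \<comment> \<open>A strictly increasing sequence of naturals satisfies
    \<open>k \<le> n k\<close>.\<close>
  moreover have "N < n k" using k(2) seq_suble[OF n, of k] by simp
  moreover have "E \<in> sets borel" "E \<subseteq> K"
    using Ks A(1) Bs sM by (auto simp: E_def)
  ultimately show ?thesis by blast
qed

section \<open>Dependent choice of the two sequences\<close>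

theorem theorem2p1:
  fixes M :: "'a::{topological_group_add, t2_space} measure"
    and p :: real
    and a :: 'a
    and \<omega> :: "'a \<Rightarrow> real"
    and \<Delta> :: "'a set"
  assumes "locally_compact_space (euclidean :: 'a topology)"
    and "right_haar_measure M"
    and "1 \<le> p"
    and "passes_through_compacts a"
    and "weight \<omega>"
    and "Lp_bounded_linear M p (weighted_translation a \<omega>)"
    and "J_class (Lp_space M p) (Lp_dist M p) (Lp_map M p (weighted_translation a \<omega>))"
    and "compact \<Delta>"
    and "0 < emeasure M \<Delta>"
  shows "\<exists>(E :: nat \<Rightarrow> 'a set) (n :: nat \<Rightarrow> nat).
      (\<forall>k. E k \<in> sets borel \<and> E k \<subseteq> \<Delta>) \<and>
      strict_mono n \<and> (\<forall>k. 0 < n k) \<and>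
      (\<lambda>k. emeasure M (E k)) \<longlonglongrightarrow> emeasure M \<Delta> \<and>
      (\<lambda>k. esssup (restrict_space M (E k)) (\<lambda>x. ennreal (omega_tilde a \<omega> (n k) x))) \<longlonglongrightarrow> 0"
proof -
  have sM: "sets M = sets borel" and \<Delta>fin: "emeasure M \<Delta> \<noteq> \<infinity>"
    using assms(2,8) by (auto simp: right_haar_measure_def less_top)
  have \<Delta>s: "\<Delta> \<in> sets M" using assms(8) sM by (simp add: borel_closed compact_imp_closed)
  \<comment> \<open>The tolerance is 1/(k+1): with \<open>k\<close> in place of
    \<open>Suc k\<close>, \<open>inverse 0 = 0\<close> would make the strict measure bound
    unsatisfiable at \<open>k = 0\<close>.\<close>
  define P where "P k nE \<longleftrightarrow> 0 < fst nE \<and> snd nE \<in> sets borel \<and> snd nE \<subseteq> \<Delta> \<and>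
      emeasure M (\<Delta> - snd nE) < ennreal (inverse (real (Suc k))) \<and>
      (\<forall>x\<in>snd nE. omega_tilde a \<omega> (fst nE) x < inverse (real (Suc k)))"
    for k and nE :: "nat \<times> 'a set"
  have ex: "\<exists>nE. P k nE \<and> N < fst nE" for k N
  proof -
    obtain n E where "N < n" "E \<in> sets borel" "E \<subseteq> \<Delta>"
        "emeasure M (\<Delta> - E) < ennreal (inverse (real (Suc k)))"
        "\<forall>x\<in>E. omega_tilde a \<omega> n x < inverse (real (Suc k))"
      using J_class_omega_tilde_small[OF assms(2-8), of "inverse (real (Suc k))" N] by auto
    then show ?thesis by (intro exI[of _ "(n, E)"]) (auto simp: P_def)
  qed
  have "\<exists>nE. \<forall>k. P k (nE k) \<and> fst (nE k) < fst (nE (Suc k))"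
    by (rule dependent_nat_choice) (use ex in blast)+
  then obtain nE where nE: "\<And>k. P k (nE k)" "\<And>k. fst (nE k) < fst (nE (Suc k))" by blast
  define n E where "n k = fst (nE k)" and "E k = snd (nE k)" for k
  have E: "E k \<in> sets borel" "E k \<subseteq> \<Delta>" "0 < n k"
      "emeasure M (\<Delta> - E k) < ennreal (inverse (real (Suc k)))"
      "\<And>x. x \<in> E k \<Longrightarrow> omega_tilde a \<omega> (n k) x < inverse (real (Suc k))" for k
    using nE(1)[of k] by (auto simp: P_def n_def E_def)
  have lim: "(\<lambda>k. ennreal (inverse (real (Suc k)))) \<longlonglongrightarrow> 0"
    using LIMSEQ_inverse_real_of_nat by (simp flip: ennreal_0)
  have "(\<lambda>k. emeasure M (\<Delta> - E k)) \<longlonglongrightarrow> 0"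
    by (rule tendsto_sandwich[OF _ _ tendsto_const lim])
      (auto intro!: always_eventually less_imp_le E(4)[simplified])
  \<comment> \<open>Finiteness of the measure of \<open>\<Delta>\<close> makes subtraction in
    \<open>ennreal\<close> continuous here, so small complements give the convergence of the
    measures.\<close>
  then have "(\<lambda>k. emeasure M \<Delta> - emeasure M (\<Delta> - E k)) \<longlonglongrightarrow> emeasure M \<Delta> - 0"
    using \<Delta>fin by (intro tendsto_diff_ennreal tendsto_const) auto
  moreover have "emeasure M \<Delta> - emeasure M (\<Delta> - E k) = emeasure M (E k)" for k
  proof -
    have "emeasure M (\<Delta> - (\<Delta> - E k)) = emeasure M \<Delta> - emeasure M (\<Delta> - E k)"
      using E(1,4)[of k] \<Delta>s sM by (intro emeasure_Diff) auto
    moreover have "\<Delta> - (\<Delta> - E k) = E k" using E(2)[of k] by auto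
    ultimately show ?thesis by simp
  qed
  ultimately have "(\<lambda>k. emeasure M (E k)) \<longlonglongrightarrow> emeasure M \<Delta>" by simp
  moreover have "(\<lambda>k. esssup (restrict_space M (E k))
      (\<lambda>x. ennreal (omega_tilde a \<omega> (n k) x))) \<longlonglongrightarrow> 0"
  proof (rule tendsto_sandwich[OF _ _ tendsto_const lim])
    show "eventually (\<lambda>k. esssup (restrict_space M (E k))
        (\<lambda>x. ennreal (omega_tilde a \<omega> (n k) x)) \<le> ennreal (inverse (real (Suc k)))) sequentially"
    proof (rule always_eventually, rule allI, rule esssup_I)
      fix k
      \<comment> \<open>Measurability has to be supplied because \<open>esssup\<close> takes the
        value \<open>top\<close> on nonmeasurable functions.\<close>
      have "omega_tilde a \<omega> (n k) \<in> borel_measurable M"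
        using omega_tilde_measurable[OF assms(5)] measurable_cong_sets[OF sM refl] by blast
      then show "(\<lambda>x. ennreal (omega_tilde a \<omega> (n k) x)) \<in> borel_measurable (restrict_space M (E k))"
        by (intro measurable_restrict_space1 measurable_compose[OF _ measurable_ennreal])
      show "AE x in restrict_space M (E k).
          ennreal (omega_tilde a \<omega> (n k) x) \<le> ennreal (inverse (real (Suc k)))"
        by (intro AE_I2 ennreal_leI less_imp_le E(5)) (simp add: space_restrict_space)
    qed
  qed simp
  moreover have "strict_mono n" using nE(2) by (simp add: n_def strict_mono_Suc_iff)
  ultimately show ?thesis using E(1-3) by blast
qed

end
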